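(* For every $d\ge 2$, there exists a nested Galerkin sequence $(A_k)_{k=0}^\infty$ of matrices $A_k\in\mathbb{R}^{N_k\times d}$.
   Context: $\mathcal{K}_c(\mathbb{R}^d)$ is the space of all nonempty convex compact subsets of $\mathbb{R}^d$. Put $\|C\|_2:=\sup_{c\in C}\|c\|_2$, and for nonempty closed convex $C,\tilde C\subset\mathbb{R}^d$ let $\mathrm{dist}_H(C,\tilde C):=\max\{\sup_{c\in C}\inf_{\tilde c\in\tilde C}\|c-\tilde c\|_2,\ \sup_{\tilde c\in\tilde C}\inf_{c\in C}\|c-\tilde c\|_2\}$ be the Hausdorff distance. All matrices $A\in\mathbb{R}^{N\times d}$ considered have pairwise distinct rows $a_1^T,\ldots,a_N^T$ with $\|a_i\|_2=1$. For such $A$ and $b\in\mathbb{R}^N$ put $Q_{A,b}:=\{x\in\mathbb{R}^d:Ax\le b\}$ and $\mathcal{G}_A:=\{Q_{A,b}:b\in\mathbb{R}^N\}\setminus\{\emptyset\}$. A sequence $(A_k)_{k=0}^\infty$ of matrices $A_k\in\mathbb{R}^{N_k\times d}$ with $N_k\in\mathbb{N}$ is called a Galerkin sequence if there exists a sequence $(\alpha_k)_{k=0}^\infty$ in $[0,\infty)$ with $\lim_{k\to\infty}\alpha_k=0$ such that for every $k$ $$\inf_{\tilde C\in\mathcal{G}_{A_k}}\mathrm{dist}_H(C,\tilde C)\le\alpha_k\|C\|_2\quad\forall\,C\in\mathcal{K}_c(\mathbb{R}^d).$$ If, in addition, $A_k$ is a submatrix of $A_{k+1}$ (obtained by deleting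 rows) for all $k\in\mathbb{N}$, it is called a nested Galerkin sequence. *)

theory Defs
  imports "HOL-Analysis.Analysis" "HOL-Library.Sublist"
begin

definition convex_bodies :: "(real^'d) set set" where
  "convex_bodies = {C. C \<noteq> {} \<and> convex C \<and> compact C}"

(* Intended for nonempty bounded sets, where the real supremum is the least upper bound. *)
definition set_norm :: "(real^'d) set \<Rightarrow> real" where
  "set_norm C = (SUP c\<in>C. norm c)"

(* Extended-real valued, since polyhedra may be unbounded and the distance is then infinite. *)
definition hausdorff_dist :: "(real^'d) set \<Rightarrow> (real^'d) set \<Rightarrow> ereal" where
  "hausdorff_dist C D =
     max (SUP c\<in>C. INF c'\<in>D. ereal (norm (c - c')))
         (SUP c'\<in>D. INF c\<in>C. ereal (norm (c - c')))"

(* A matrix with N rows and columns indexed by 'd is represented by the list of its N rows,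
   because N varies along the sequences considered below. *)
type_synonym 'd row_matrix = "(real^'d) list"

definition distinct_unit_rows :: "'d::finite row_matrix \<Rightarrow> bool" where
  "distinct_unit_rows A \<longleftrightarrow> distinct A \<and> (\<forall>a\<in>set A. norm a = 1)"

definition polyhedron_of :: "'d::finite row_matrix \<Rightarrow> real list \<Rightarrow> (real^'d) set" where
  "polyhedron_of A b = {x. \<forall>i<length A. (A ! i) \<bullet> x \<le> b ! i}"

definition polyhedra :: "'d::finite row_matrix \<Rightarrow> (real^'d) set set" where
  "polyhedra A = {polyhedron_of A b | b. length b = length A} - {{}}"

definition galerkin_sequence :: "(nat \<Rightarrow> 'd::finite row_matrix) \<Rightarrow> bool" where
  "galerkin_sequence A \<longleftrightarrow>
     (\<forall>k. distinct_unit_rows (A k)) \<and>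
     (\<exists>\<alpha> :: nat \<Rightarrow> real. (\<forall>k. 0 \<le> \<alpha> k) \<and> \<alpha> \<longlonglongrightarrow> 0 \<and>
        (\<forall>k. \<forall>C\<in>convex_bodies.
           (INF D\<in>polyhedra (A k). hausdorff_dist C D) \<le> ereal (\<alpha> k * set_norm C)))"

(* subseq on lists of rows: the left matrix arises from the right one by deleting rows. *)
definition nested_galerkin_sequence :: "(nat \<Rightarrow> 'd::finite row_matrix) \<Rightarrow> bool" where
  "nested_galerkin_sequence A \<longleftrightarrow>
     galerkin_sequence A \<and> (\<forall>k. subseq (A k) (A (Suc k)))"

end

theory Submission
  imports Defs
begin

text \<open>
  The rows of \<open>A k\<close> are made ever denser in the unit sphere. The natural approximation of a
  convex body \<open>C\<close> by a polyhedron with normals \<open>a\<close> is the circumscribed one, cut out by the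
  supporting half-spaces \<open>a \<bullet> x \<le> max {a \<bullet> c | c. c \<in> C}\<close>. It contains \<open>C\<close>, so only its points
  \<open>x\<close> outside \<open>C\<close> matter. If \<open>p\<close> is the point of \<open>C\<close> closest to \<open>x\<close>, the unit vector \<open>u\<close> pointing
  from \<open>p\<close> to \<open>x\<close> is an outer normal of \<open>C\<close> at \<open>p\<close>. A row \<open>a\<close> within \<open>\<delta>\<close> of \<open>u\<close> is almost such a
  normal, and so its half-space allows \<open>x\<close> to leave \<open>C\<close> only by \<open>2 * R * \<delta> / (1 - \<delta>)\<close>, where \<open>R\<close>
  is the norm of \<open>C\<close> (lemma \<open>circumscribed_point_near_body\<close>).

  Compactness of the sphere supplies finite \<open>\<delta>\<close>-nets for \<open>\<delta> = 1 / (k + 2)\<close>, for which the bound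
  is \<open>2 / (k + 1) * R\<close>. Nestedness is obtained by accumulating these nets: adding rows to a
  \<open>\<delta>\<close>-net keeps it a \<open>\<delta>\<close>-net, and new rows can be appended to the old list
  (lemma \<open>accumulating_lists\<close>).
\<close>

lemma norm_le_set_norm:
  assumes "compact C" "c \<in> C"
  shows "norm c \<le> set_norm C"
  unfolding set_norm_def
proof (rule cSUP_upper[OF assms(2) bounded_imp_bdd_above])
  show "bounded (norm ` C)"
    using compact_imp_bounded[OF assms(1)] bounded_norm_comp[of "\<lambda>x. x" C] by simp
qed

text \<open>
  Since \<open>u = (x - p) / norm (x - p)\<close> satisfies \<open>u \<bullet> (c - p) \<le> 0\<close>, replacing \<open>u\<close> by \<open>a\<close> in both
  \<open>u \<bullet> (x - p) = norm (x - p)\<close> and \<open>u \<bullet> (c - p) \<le> 0\<close> costs at most \<open>\<delta> * norm (x - p)\<close> and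
  \<open>\<delta> * norm (c - p)\<close>. The constraint \<open>a \<bullet> x \<le> a \<bullet> c\<close> compares the two.
\<close>

lemma circumscribed_point_near_body:
  fixes C :: "(real^'d) set"
  assumes C: "C \<in> convex_bodies"
    and "\<delta> < 1"
    and net: "\<And>u. norm u = 1 \<Longrightarrow> \<exists>a\<in>N. norm (a - u) \<le> \<delta>"
    and x: "\<And>a. a \<in> N \<Longrightarrow> \<exists>c\<in>C. a \<bullet> x \<le> a \<bullet> c"
  shows "\<exists>p\<in>C. norm (p - x) \<le> 2 * \<delta> / (1 - \<delta>) * set_norm C"
proof -
  have ne: "C \<noteq> {}" and "convex C" and "compact C"
    using C by (auto simp: convex_bodies_def)
  define p where "p = closest_point C x"
  have "closed C"
    using \<open>compact C\<close> by (rule compact_imp_closed)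
  have p: "p \<in> C"
    unfolding p_def using closest_point_in_set[OF \<open>closed C\<close> ne] .
  show ?thesis
  proof (cases "x = p")
    case True
    \<comment> \<open>No direction \<open>u\<close> is available here, and \<open>0 \<le> \<delta>\<close> comes from applying the net to any
        unit vector.\<close>
    obtain u :: "real^'d" where "norm u = 1"
      using vector_choose_size[of 1] by auto
    then obtain a where "norm (a - u) \<le> \<delta>"
      using net by auto
    then have "0 \<le> \<delta>"
      by (rule order_trans[OF norm_ge_zero])
    moreover have "0 \<le> set_norm C"
      using order_trans[OF norm_ge_zero norm_le_set_norm[OF \<open>compact C\<close> p]] .
    ultimately show ?thesis
      using True p \<open>\<delta> < 1\<close> by (intro bexI[of _ p]) simp_all
  next
    case False
    define r where "r = norm (x - p)"
    define u where "u = (x - p) /\<^sub>R r"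
    have r: "0 < r"
      using False by (simp add: r_def)
    have u: "norm u = 1" and xp: "x - p = r *\<^sub>R u"
      using r by (simp_all add: u_def r_def)
    obtain a where a: "a \<in> N" "norm (a - u) \<le> \<delta>"
      using net[OF u] by auto
    obtain c where c: "c \<in> C" "a \<bullet> x \<le> a \<bullet> c"
      using x[OF a(1)] by auto
    have "r * (u \<bullet> (c - p)) \<le> 0"
      using closest_point_dot[OF \<open>convex C\<close> \<open>closed C\<close> c(1), of x] xp
      by (simp add: p_def)
    then have normal: "u \<bullet> (c - p) \<le> 0"
      using r by (simp add: mult_le_0_iff)
    have dev: "\<bar>(a - u) \<bullet> y\<bar> \<le> \<delta> * norm y" for y
      using Cauchy_Schwarz_ineq2[of "a - u" y] mult_right_mono[OF a(2) norm_ge_zero[of y]]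
      by linarith
    have "u \<bullet> (x - p) = r"
      using u xp by (simp add: dot_square_norm)
    then have "(1 - \<delta>) * r \<le> a \<bullet> (x - p)"
      using dev[of "x - p"] by (simp add: inner_diff_left r_def algebra_simps)
    also have "\<dots> \<le> a \<bullet> (c - p)"
      using c(2) by (simp add: inner_diff_right)
    also have "\<dots> \<le> \<delta> * norm (c - p)"
      using normal dev[of "c - p"] by (simp add: inner_diff_left)
    also have "\<dots> \<le> \<delta> * (2 * set_norm C)"
    proof (rule mult_left_mono)
      show "norm (c - p) \<le> 2 * set_norm C"
        using norm_triangle_ineq4[of c p] norm_le_set_norm[OF \<open>compact C\<close> c(1)]
          norm_le_set_norm[OF \<open>compact C\<close> p] by linarith
      show "0 \<le> \<delta>"
        using order_trans[OF norm_ge_zero a(2)] .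
    qed
    finally have "r \<le> 2 * \<delta> / (1 - \<delta>) * set_norm C"
      using \<open>\<delta> < 1\<close> by (simp add: field_simps)
    then show ?thesis
      using p by (auto simp: r_def norm_minus_commute)
  qed
qed

lemma hausdorff_dist_superset_le:
  assumes "C \<subseteq> D" "0 \<le> r"
    and near: "\<And>x. x \<in> D \<Longrightarrow> \<exists>p\<in>C. norm (p - x) \<le> r"
  shows "hausdorff_dist C D \<le> ereal r"
  unfolding hausdorff_dist_def
proof (rule max.boundedI; rule SUP_least)
  fix c assume "c \<in> C"
  then show "(INF c'\<in>D. ereal (norm (c - c'))) \<le> ereal r"
    using assms(1,2) by (intro INF_lower2[of c]) auto
next
  fix x assume "x \<in> D"
  then obtain p where "p \<in> C" "norm (p - x) \<le> r"
    using near by blast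
  then show "(INF c\<in>C. ereal (norm (c - x))) \<le> ereal r"
    by (intro INF_lower2[of p]) auto
qed

lemma polyhedral_approximation_of_net:
  fixes A :: "'d::finite row_matrix"
  assumes C: "C \<in> convex_bodies"
    and \<delta>: "0 \<le> \<delta>" "\<delta> < 1"
    and net: "\<And>u. norm u = 1 \<Longrightarrow> \<exists>a\<in>set A. norm (a - u) \<le> \<delta>"
  shows "(INF D\<in>polyhedra A. hausdorff_dist C D) \<le> ereal (2 * \<delta> / (1 - \<delta>) * set_norm C)"
proof -
  have ne: "C \<noteq> {}" and "compact C"
    using C by (auto simp: convex_bodies_def)
  have "\<exists>c\<in>C. \<forall>y\<in>C. a \<bullet> y \<le> a \<bullet> c" for a
    using continuous_attains_sup[OF \<open>compact C\<close> ne, of "\<lambda>y. a \<bullet> y"]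
    by (simp add: continuous_on_inner)
  then obtain s where s: "\<And>a. s a \<in> C" "\<And>a y. y \<in> C \<Longrightarrow> a \<bullet> y \<le> a \<bullet> s a"
    by metis
  define D where "D = polyhedron_of A (map (\<lambda>a. a \<bullet> s a) A)"
  have D: "x \<in> D \<longleftrightarrow> (\<forall>a\<in>set A. a \<bullet> x \<le> a \<bullet> s a)" for x
    by (auto simp: D_def polyhedron_of_def all_set_conv_all_nth)
  have sub: "C \<subseteq> D"
    using s(2) by (auto simp: D)
  obtain c where "c \<in> C"
    using ne by auto
  then have "0 \<le> set_norm C"
    using order_trans[OF norm_ge_zero norm_le_set_norm[OF \<open>compact C\<close>]] by simp
  have "hausdorff_dist C D \<le> ereal (2 * \<delta> / (1 - \<delta>) * set_norm C)"
  proof (rule hausdorff_dist_superset_le[OF sub])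
    show "0 \<le> 2 * \<delta> / (1 - \<delta>) * set_norm C"
      using \<delta> \<open>0 \<le> set_norm C\<close> by simp
    fix x assume "x \<in> D"
    then show "\<exists>p\<in>C. norm (p - x) \<le> 2 * \<delta> / (1 - \<delta>) * set_norm C"
      using circumscribed_point_near_body[OF C \<delta>(2) net] s(1) by (metis D)
  qed
  moreover have "D \<in> polyhedra A"
    using sub ne by (auto simp: polyhedra_def D_def)
  ultimately show ?thesis
    by (intro INF_lower2)
qed

lemma finite_net_of_sphere:
  fixes \<delta> :: real
  assumes "0 < \<delta>"
  shows "\<exists>F\<subseteq>sphere (0 :: 'a::euclidean_space) 1. finite F \<and>
    (\<forall>u. norm u = 1 \<longrightarrow> (\<exists>a\<in>F. norm (a - u) \<le> \<delta>))"
proof -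
  have "sphere (0::'a) 1 \<subseteq> (\<Union>a\<in>sphere 0 1. ball a \<delta>)"
    using assms by force
  then obtain F where F: "F \<subseteq> sphere (0::'a) 1" "finite F" "sphere 0 1 \<subseteq> (\<Union>a\<in>F. ball a \<delta>)"
    using compactE_image[OF compact_sphere] open_ball by metis
  have "\<exists>a\<in>F. norm (a - u) \<le> \<delta>" if "norm u = 1" for u
  proof -
    have "u \<in> (\<Union>a\<in>F. ball a \<delta>)"
      using that by (intro subsetD[OF F(3)]) simp
    then show ?thesis
      by (force simp: dist_norm)
  qed
  then show ?thesis
    using F(1,2) by blast
qed

text \<open>
  Each list extends its predecessor by the genuinely new elements only: this keeps the entries
  distinct and the earlier list a subsequence.
\<close>

lemma accumulating_lists:
  fixes F :: "nat \<Rightarrow> 'a set"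
  assumes fin: "\<And>k. finite (F k)"
  shows "\<exists>A. \<forall>k. distinct (A k) \<and> set (A k) = (\<Union>j\<le>k. F j) \<and> subseq (A k) (A (Suc k))"
proof -
  have "\<exists>A. \<forall>k. (distinct (A k) \<and> set (A k) = (\<Union>j\<le>k. F j)) \<and> subseq (A k) (A (Suc k))"
  proof (rule dependent_nat_choice)
    show "\<exists>xs. distinct xs \<and> set xs = (\<Union>j\<le>0. F j)"
      using finite_distinct_list[OF fin[of 0]] by auto
    fix xs k assume xs: "distinct xs \<and> set xs = (\<Union>j\<le>k. F j)"
    obtain ys where ys: "set ys = F (Suc k) - set xs" "distinct ys"
      using finite_distinct_list[of "F (Suc k) - set xs"] fin by auto
    have "distinct (xs @ ys) \<and> set (xs @ ys) = (\<Union>j\<le>Suc k. F j)"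
      using xs ys by (auto simp: atMost_Suc)
    then show "\<exists>zs. (distinct zs \<and> set zs = (\<Union>j\<le>Suc k. F j)) \<and> subseq xs zs"
      by (intro exI[of _ "xs @ ys"] conjI list_emb_prefix) simp_all
  qed
  then show ?thesis
    by simp
qed

theorem theorem47:
  assumes "CARD('d::finite) \<ge> 2"
  shows "\<exists>A :: nat \<Rightarrow> 'd row_matrix. nested_galerkin_sequence A"
proof -
  \<comment> \<open>The mesh \<open>\<delta> k\<close> has to be below 1 already for \<open>k = 0\<close>, since the Galerkin estimate is
      required of every member of the sequence.\<close>
  define \<delta> where "\<delta> k = 1 / (real k + 2)" for k
  have \<delta>: "0 < \<delta> k" "\<delta> k < 1" for k
    by (simp_all add: \<delta>_def)
  have "\<forall>k. \<exists>F. F \<subseteq> sphere (0 :: real^'d) 1 \<and> finite F \<and>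
      (\<forall>u. norm u = 1 \<longrightarrow> (\<exists>a\<in>F. norm (a - u) \<le> \<delta> k))"
    by (intro allI finite_net_of_sphere \<delta>(1))
  from choice[OF this] obtain F :: "nat \<Rightarrow> (real^'d) set" where
    nets: "\<forall>k. F k \<subseteq> sphere 0 1 \<and> finite (F k) \<and>
      (\<forall>u. norm u = 1 \<longrightarrow> (\<exists>a\<in>F k. norm (a - u) \<le> \<delta> k))" ..
  have F: "F k \<subseteq> sphere 0 1" "finite (F k)"
      "norm u = 1 \<Longrightarrow> \<exists>a\<in>F k. norm (a - u) \<le> \<delta> k" for k u
    using nets[rule_format, of k] by simp_all
  from accumulating_lists[OF F(2)] obtain A where
    lists: "\<forall>k. distinct (A k) \<and> set (A k) = (\<Union>j\<le>k. F j) \<and> subseq (A k) (A (Suc k))" ..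
  have A: "distinct (A k)" "set (A k) = (\<Union>j\<le>k. F j)" "subseq (A k) (A (Suc k))" for k
    using lists by simp_all
  define \<alpha> where "\<alpha> k = 2 * \<delta> k / (1 - \<delta> k)" for k
  have "distinct_unit_rows (A k)" for k
    using A(1,2) F(1) by (fastforce simp: distinct_unit_rows_def)
  moreover have "0 \<le> \<alpha> k" for k
    using \<delta>[of k] by (simp add: \<alpha>_def)
  moreover have "\<alpha> \<longlonglongrightarrow> 0"
  proof -
    have "1 - \<delta> k = real (Suc k) / (real k + 2)" for k
      by (simp add: \<delta>_def field_simps)
    moreover have "real k + 2 \<noteq> 0" for k
      by linarith
    ultimately have "\<alpha> = (\<lambda>k. 2 * inverse (real (Suc k)))"
      by (simp add: fun_eq_iff \<alpha>_def \<delta>_def divide_inverse)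
    then show ?thesis
      using tendsto_mult_right_zero[OF LIMSEQ_inverse_real_of_nat, of 2] by simp
  qed
  moreover have "(INF D\<in>polyhedra (A k). hausdorff_dist C D) \<le> ereal (\<alpha> k * set_norm C)"
    if "C \<in> convex_bodies" for k C
    unfolding \<alpha>_def
  proof (rule polyhedral_approximation_of_net[OF that less_imp_le[OF \<delta>(1)] \<delta>(2)])
    fix u :: "real^'d" assume "norm u = 1"
    then show "\<exists>a\<in>set (A k). norm (a - u) \<le> \<delta> k"
      using F(3)[of u k] A(2) by blast
  qed
  ultimately have "galerkin_sequence A"
    unfolding galerkin_sequence_def by blast
  then show ?thesis
    using A(3) by (auto simp: nested_galerkin_sequence_def)
qed

end
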